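(* Let $G$ be a graph of finite corner rank $\alpha\ge 2$. Then every Lower Way strategy is an optimal strategy for the cop on $G$, and every Higher Way strategy is an optimal strategy for the robber on $G$.
   Context: All graphs are finite, nonempty and reflexive (every vertex is adjacent to itself); $N[v]$ is the closed neighborhood. For distinct vertices $v,w$ of a graph $H$: $w$ corners $v$ in $H$ if every vertex of $H$ adjacent to $v$ is adjacent to $w$; $w$ strictly corners $v$ in $H$ if moreover some vertex of $H$ adjacent to $w$ is not adjacent to $v$; a strict corner of $H$ is a vertex strictly cornered in $H$ by another vertex. For a vertex set, "$c$ corners $x$ in $H$" is also used when $c=x$ (trivially true). Corner ranking: set $G_1=G$, $k=1$. If $G_k$ is a clique, give all its vertices rank $k$ and stop. Else if $G_k$ has no strict corners, give all its vertices rank $\infty$ and stop. Else give the set $X$ of strict corners of $G_k$ rank $k$, put $G_{k+1}=G_k-X$ (induced subgraph on the remaining vertices), increase $k$, repeat. $\mathrm{cr}(v)$ is the rank of $v$; $\mathrm{cr}(G)$ is the maximum rank ($\infty$ largest). For $G$ of finite corner rank $\alpha\ge2$: $G$ is $1$-cop-win ($r=1$) if some (equivalently every) vertex of rank $\alpha$ is adjacent to all vertices of $G_{\alpha-1}$, otherwise $0$-cop-win ($r=0$). Projections: for each $k$ such that $G_{k+1}$ is defined, define $f_k$ from nonempty subsets of $V(G_k)$ to nonempty subsets of $V(G_{k+1})$ by $f_k(\{u\})=\{u\}$ if $\mathrm{cr}(u)>k$, and otherwise $f_k(\{u\})$ = the set of vertices of $G_{k+1}$ that strictly corner $u$ in $G_k$;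 and $f_k(S)=\bigcup_{u\in S}f_k(\{u\})$. Let $F_1$ be the identity and $F_k=f_{k-1}\circ\cdots\circ f_1$; write $F_k(v)=F_k(\{v\})$. Game: cop places, then robber places, then alternate moves with the cop first; a move is staying or moving to an adjacent vertex; cop wins on sharing a vertex. Capture time $\operatorname{capt}(G)$: minimum number of cop moves (placement not counted) guaranteeing a win. A cop strategy is optimal if it wins within $\operatorname{capt}(G)$ cop moves against every robber; a robber strategy is optimal if against every cop strategy the cop needs at least $\operatorname{capt}(G)$ moves. Cop strategies: the robber at $x$ is $0$-cornered by the cop at $c$ if $c=x$; for $k\ge1$, $x$ is $k$-cornered by $c$ if some $x'\in F_k(x)$ is cornered by $c$ in the subgraph induced by $V(G_k)\cup\{c\}$ (not necessarily strictly; $c=x'$ allowed). An initial cop placement is standard if the vertex is adjacent to every vertex of $G_{\alpha-r}$. A Lower Way strategy is a cop strategy with a standard initial placement such that for every $t\ge1$, after $t$ cop moves the cop $k$-corners the robber for some $k\le\alpha-r-t$. Robber strategies: with the cop at $c$, a vertex $x$ is $k$-proj-safe if $\mathrm{cr}(x)\ge k$ and some $c'\in F_k(c)$ is not adjacent to $x$. A Higher Way strategy: at every turn (including the initial placement) the robber goes to a $k$-proj-safe vertex with $k$ maximum; if none is available, he moves arbitrarily to a vertex not occupied by the cop. *)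

theory Defs
  imports Main "HOL-Library.Extended_Nat"
begin

section \<open>Reflexive graphs and corners\<close>

definition reflexive_graph :: "'a set \<Rightarrow> ('a \<times> 'a) set \<Rightarrow> bool" where
  "reflexive_graph V E \<longleftrightarrow>
     finite V \<and> V \<noteq> {} \<and> E \<subseteq> V \<times> V \<and> (\<forall>v\<in>V. (v, v) \<in> E) \<and> sym E"

text \<open>An induced subgraph of \<open>(V, E)\<close> is represented by its vertex set \<open>H\<close>, with adjacency
  still read off from \<open>E\<close>.\<close>

definition is_clique :: "('a \<times> 'a) set \<Rightarrow> 'a set \<Rightarrow> bool" where
  "is_clique E H \<longleftrightarrow> (\<forall>u\<in>H. \<forall>v\<in>H. (u, v) \<in> E)"

text \<open>\<open>corners E H w v\<close>: \<open>w\<close> corners \<open>v\<close> in \<open>H\<close>. The degenerate case \<open>w = v\<close> is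
  admitted (and holds trivially).\<close>

definition corners :: "('a \<times> 'a) set \<Rightarrow> 'a set \<Rightarrow> 'a \<Rightarrow> 'a \<Rightarrow> bool" where
  "corners E H w v \<longleftrightarrow> w \<in> H \<and> v \<in> H \<and> (\<forall>u\<in>H. (v, u) \<in> E \<longrightarrow> (w, u) \<in> E)"

definition strictly_corners :: "('a \<times> 'a) set \<Rightarrow> 'a set \<Rightarrow> 'a \<Rightarrow> 'a \<Rightarrow> bool" where
  "strictly_corners E H w v \<longleftrightarrow>
     w \<noteq> v \<and> corners E H w v \<and> (\<exists>u\<in>H. (w, u) \<in> E \<and> (v, u) \<notin> E)"

definition strict_corners :: "('a \<times> 'a) set \<Rightarrow> 'a set \<Rightarrow> 'a set" where
  "strict_corners E H = {v. \<exists>w. strictly_corners E H w v}"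


section \<open>Corner ranking\<close>

text \<open>\<open>stage V E k\<close> is the vertex set of \<open>G\<^sub>k\<close> for \<open>k \<ge> 1\<close>. When the ranking procedure has
  already stopped, so that \<open>G\<^sub>k\<close> is not defined, it is the empty set; a \<open>G\<^sub>k\<close> that is defined is
  never empty, since a vertex of maximal degree is not a strict corner.\<close>

fun stage :: "'a set \<Rightarrow> ('a \<times> 'a) set \<Rightarrow> nat \<Rightarrow> 'a set" where
  "stage V E 0 = {}"
| "stage V E (Suc 0) = V"
| "stage V E (Suc (Suc k)) =
     (let H = stage V E (Suc k) in
      if is_clique E H \<or> strict_corners E H = {} then {} else H - strict_corners E H)"

definition gets_rank :: "'a set \<Rightarrow> ('a \<times> 'a) set \<Rightarrow> 'a \<Rightarrow> nat \<Rightarrow> bool" where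
  "gets_rank V E v k \<longleftrightarrow>
     v \<in> stage V E k \<and> (is_clique E (stage V E k) \<or> v \<in> strict_corners E (stage V E k))"

text \<open>A vertex gets at most one finite rank. On a finite graph the procedure stops, so a vertex
  without a finite rank lies in a last \<open>G\<^sub>k\<close> that is no clique and has no strict corners.\<close>

definition corner_rank :: "'a set \<Rightarrow> ('a \<times> 'a) set \<Rightarrow> 'a \<Rightarrow> enat" where
  "corner_rank V E v =
     (if \<exists>k. gets_rank V E v k then enat (LEAST k. gets_rank V E v k) else \<infinity>)"

definition graph_corner_rank :: "'a set \<Rightarrow> ('a \<times> 'a) set \<Rightarrow> enat" where
  "graph_corner_rank V E = Max (corner_rank V E ` V)"

text \<open>In what follows \<open>\<alpha>\<close> stands for the corner rank of the graph, assumed finite and at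
  least 2. The number \<open>r\<close> is 1 if the graph is 1-cop-win and 0 if it is 0-cop-win.\<close>

definition win_type :: "'a set \<Rightarrow> ('a \<times> 'a) set \<Rightarrow> nat \<Rightarrow> nat" where
  "win_type V E \<alpha> =
     (if \<exists>v\<in>V. corner_rank V E v = enat \<alpha> \<and> (\<forall>u\<in>stage V E (\<alpha> - 1). (v, u) \<in> E)
      then 1 else 0)"


section \<open>Projections\<close>

definition proj_step :: "'a set \<Rightarrow> ('a \<times> 'a) set \<Rightarrow> nat \<Rightarrow> 'a set \<Rightarrow> 'a set" where
  "proj_step V E k S =
     (\<Union>u\<in>S. if enat k < corner_rank V E u then {u}
            else {w \<in> stage V E (Suc k). strictly_corners E (stage V E k) w u})"

text \<open>\<open>proj V E k S\<close> is \<open>F\<^sub>k(S)\<close>, for \<open>k \<ge> 1\<close> with \<open>G\<^sub>k\<close> defined; index 0 is junk.\<close>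

fun proj :: "'a set \<Rightarrow> ('a \<times> 'a) set \<Rightarrow> nat \<Rightarrow> 'a set \<Rightarrow> 'a set" where
  "proj V E 0 S = S"
| "proj V E (Suc 0) S = S"
| "proj V E (Suc (Suc k)) S = proj_step V E (Suc k) (proj V E (Suc k) S)"


section \<open>The game\<close>

text \<open>A history is the list \<open>[c\<^sub>0, r\<^sub>0, c\<^sub>1, r\<^sub>1, \<dots>]\<close> of the positions chosen so far, cop and
  robber alternating, placements included. The player to move is the cop if its length is even
  and the robber if it is odd; his current position (if he has been placed) is the last but one
  entry, and his opponent's is the last one. Hence the players share a vertex at some point iff
  two consecutive entries are equal.\<close>

definition captured :: "'a list \<Rightarrow> bool" where
  "captured h \<longleftrightarrow> (\<exists>i. Suc i < length h \<and> h ! i = h ! Suc i)"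

definition legal_history :: "'a set \<Rightarrow> ('a \<times> 'a) set \<Rightarrow> 'a list \<Rightarrow> bool" where
  "legal_history V E h \<longleftrightarrow>
     set h \<subseteq> V \<and> (\<forall>i. i + 2 < length h \<longrightarrow> (h ! i, h ! (i + 2)) \<in> E)"

definition available :: "'a set \<Rightarrow> ('a \<times> 'a) set \<Rightarrow> 'a list \<Rightarrow> 'a set" where
  "available V E h = {v \<in> V. 2 \<le> length h \<longrightarrow> (h ! (length h - 2), v) \<in> E}"

text \<open>A strategy may depend on the whole history. It has to prescribe legal moves as long as the
  robber has not been captured; its other values are irrelevant.\<close>

definition cop_strategy :: "'a set \<Rightarrow> ('a \<times> 'a) set \<Rightarrow> ('a list \<Rightarrow> 'a) \<Rightarrow> bool" where
  "cop_strategy V E \<sigma> \<longleftrightarrow>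
     (\<forall>h. legal_history V E h \<and> \<not> captured h \<and> even (length h) \<longrightarrow> \<sigma> h \<in> available V E h)"

definition robber_strategy :: "'a set \<Rightarrow> ('a \<times> 'a) set \<Rightarrow> ('a list \<Rightarrow> 'a) \<Rightarrow> bool" where
  "robber_strategy V E \<tau> \<longleftrightarrow>
     (\<forall>h. legal_history V E h \<and> \<not> captured h \<and> odd (length h) \<longrightarrow> \<tau> h \<in> available V E h)"

fun play :: "('a list \<Rightarrow> 'a) \<Rightarrow> ('a list \<Rightarrow> 'a) \<Rightarrow> nat \<Rightarrow> 'a list" where
  "play \<sigma> \<tau> 0 = []"
| "play \<sigma> \<tau> (Suc n) =
     play \<sigma> \<tau> n @ [if even n then \<sigma> (play \<sigma> \<tau> n) else \<tau> (play \<sigma> \<tau> n)]"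

text \<open>The history of length \<open>2 n + 2\<close> consists of both placements, \<open>n\<close> cop moves and \<open>n\<close> robber
  moves.\<close>

definition captured_within :: "nat \<Rightarrow> ('a list \<Rightarrow> 'a) \<Rightarrow> ('a list \<Rightarrow> 'a) \<Rightarrow> bool" where
  "captured_within n \<sigma> \<tau> \<longleftrightarrow> captured (play \<sigma> \<tau> (2 * n + 2))"

definition wins_within :: "'a set \<Rightarrow> ('a \<times> 'a) set \<Rightarrow> nat \<Rightarrow> ('a list \<Rightarrow> 'a) \<Rightarrow> bool" where
  "wins_within V E n \<sigma> \<longleftrightarrow> (\<forall>\<tau>. robber_strategy V E \<tau> \<longrightarrow> captured_within n \<sigma> \<tau>)"

definition capt :: "'a set \<Rightarrow> ('a \<times> 'a) set \<Rightarrow> enat" where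
  "capt V E = Inf {enat n |n. \<exists>\<sigma>. cop_strategy V E \<sigma> \<and> wins_within V E n \<sigma>}"

definition optimal_cop :: "'a set \<Rightarrow> ('a \<times> 'a) set \<Rightarrow> ('a list \<Rightarrow> 'a) \<Rightarrow> bool" where
  "optimal_cop V E \<sigma> \<longleftrightarrow>
     cop_strategy V E \<sigma> \<and> (\<exists>n. capt V E = enat n \<and> wins_within V E n \<sigma>)"

definition optimal_robber :: "'a set \<Rightarrow> ('a \<times> 'a) set \<Rightarrow> ('a list \<Rightarrow> 'a) \<Rightarrow> bool" where
  "optimal_robber V E \<tau> \<longleftrightarrow>
     robber_strategy V E \<tau> \<and>
     (\<forall>\<sigma> n. cop_strategy V E \<sigma> \<and> captured_within n \<sigma> \<tau> \<longrightarrow> capt V E \<le> enat n)"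


section \<open>Lower Way strategies\<close>

text \<open>\<open>k_cornered V E k c x\<close>: the robber at \<open>x\<close> is \<open>k\<close>-cornered by the cop at \<open>c\<close>.\<close>

definition k_cornered :: "'a set \<Rightarrow> ('a \<times> 'a) set \<Rightarrow> nat \<Rightarrow> 'a \<Rightarrow> 'a \<Rightarrow> bool" where
  "k_cornered V E k c x \<longleftrightarrow>
     (if k = 0 then c = x
      else \<exists>x'\<in>proj V E k {x}. corners E (insert c (stage V E k)) c x')"

definition standard_placement :: "'a set \<Rightarrow> ('a \<times> 'a) set \<Rightarrow> nat \<Rightarrow> 'a \<Rightarrow> bool" where
  "standard_placement V E \<alpha> c \<longleftrightarrow>
     c \<in> V \<and> (\<forall>u\<in>stage V E (\<alpha> - win_type V E \<alpha>). (c, u) \<in> E)"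

text \<open>The history of length \<open>2 t\<close> is the one in which the cop is about to make his \<open>t\<close>-th move;
  this move takes place only if the robber has not been captured before. The inequality
  \<open>k \<le> \<alpha> - r - t\<close> is written without subtraction, as the right-hand side could be
  negative.\<close>

definition lower_way :: "'a set \<Rightarrow> ('a \<times> 'a) set \<Rightarrow> nat \<Rightarrow> ('a list \<Rightarrow> 'a) \<Rightarrow> bool" where
  "lower_way V E \<alpha> \<sigma> \<longleftrightarrow>
     cop_strategy V E \<sigma> \<and> standard_placement V E \<alpha> (\<sigma> []) \<and>
     (\<forall>\<tau> t. robber_strategy V E \<tau> \<and> 1 \<le> t \<and> \<not> captured (play \<sigma> \<tau> (2 * t)) \<longrightarrow>
        (let h = play \<sigma> \<tau> (2 * t) in
         \<exists>k. k + win_type V E \<alpha> + t \<le> \<alpha> \<and> k_cornered V E k (\<sigma> h) (last h)))"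


section \<open>Higher Way strategies\<close>

text \<open>\<open>proj_safe V E k c x\<close>: with the cop at \<open>c\<close>, the vertex \<open>x\<close> is \<open>k\<close>-proj-safe.\<close>

definition proj_safe :: "'a set \<Rightarrow> ('a \<times> 'a) set \<Rightarrow> nat \<Rightarrow> 'a \<Rightarrow> 'a \<Rightarrow> bool" where
  "proj_safe V E k c x \<longleftrightarrow>
     1 \<le> k \<and> x \<in> V \<and> enat k \<le> corner_rank V E x \<and> (\<exists>c'\<in>proj V E k {c}. (c', x) \<notin> E)"

definition higher_way_choice ::
    "'a set \<Rightarrow> ('a \<times> 'a) set \<Rightarrow> 'a set \<Rightarrow> 'a \<Rightarrow> 'a \<Rightarrow> bool" where
  "higher_way_choice V E A c x \<longleftrightarrow>
     x \<in> A \<and>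
     (if \<exists>k. \<exists>y\<in>A. proj_safe V E k c y
      then \<exists>k. proj_safe V E k c x \<and> (\<forall>j. \<forall>y\<in>A. proj_safe V E j c y \<longrightarrow> j \<le> k)
      else x \<noteq> c)"

text \<open>The history of length \<open>2 t + 1\<close> is the one at the robber's turn after \<open>t\<close> cop moves;
  \<open>t = 0\<close> is his initial placement.\<close>

definition higher_way :: "'a set \<Rightarrow> ('a \<times> 'a) set \<Rightarrow> ('a list \<Rightarrow> 'a) \<Rightarrow> bool" where
  "higher_way V E \<tau> \<longleftrightarrow>
     robber_strategy V E \<tau> \<and>
     (\<forall>\<sigma> t. cop_strategy V E \<sigma> \<and> \<not> captured (play \<sigma> \<tau> (2 * t + 1)) \<longrightarrow>
        (let h = play \<sigma> \<tau> (2 * t + 1) in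
         higher_way_choice V E (available V E h) (last h) (\<tau> h)))"

end

theory Submission
  imports Defs
begin

text \<open>Write \<open>m = \<alpha> - r\<close>. The projections \<open>F\<^sub>k\<close> send adjacent vertices to completely adjacent subsets
  of \<open>G\<^sub>k\<close>. Hence a cop who starts at a vertex dominating \<open>G\<^sub>m\<close> and answers the robber at \<open>x\<close> with
  a vertex of \<open>F\<^sub>k(x)\<close>, where \<open>k\<close> decreases from \<open>m\<close> to 1, moves legally and wins with his \<open>m\<close>-th
  move. Conversely, no vertex dominates \<open>G\<^sub>k\<close> for \<open>k < m\<close>, so the robber has an
  \<open>(m - 1)\<close>-proj-safe placement, and whenever he is \<open>k\<close>-proj-safe for some \<open>k \<ge> 2\<close>, each cop move
  leaves him a \<open>(k - 1)\<close>-proj-safe answer; proj-safety prevents capture by the next cop move.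
  So the capture time is \<open>m\<close>.\<close>

section \<open>Plays as sequences of positions\<close>

text \<open>The vertex chosen at turn \<open>n\<close>: even turns belong to the cop, odd ones to
  the robber, and turns 0 and 1 are the placements. The cop's \<open>t\<close>-th move is thus turn
  \<open>2 * t\<close>, in reply to the robber's turn \<open>2 * t - 1\<close>.\<close>

definition pos :: "('a list \<Rightarrow> 'a) \<Rightarrow> ('a list \<Rightarrow> 'a) \<Rightarrow> nat \<Rightarrow> 'a" where
  "pos \<sigma> \<tau> n = (if even n then \<sigma> (play \<sigma> \<tau> n) else \<tau> (play \<sigma> \<tau> n))"

lemma play_eq_map_pos: "play \<sigma> \<tau> n = map (pos \<sigma> \<tau>) [0..<n]"
  by (induction n) (simp_all add: pos_def)

declare play.simps(2) [simp del]

lemma length_play [simp]: "length (play \<sigma> \<tau> n) = n"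
  by (simp add: play_eq_map_pos)

lemma play_eq_Nil_iff [simp]: "play \<sigma> \<tau> n = [] \<longleftrightarrow> n = 0"
  by (simp add: play_eq_map_pos)

lemma nth_play [simp]: "i < n \<Longrightarrow> play \<sigma> \<tau> n ! i = pos \<sigma> \<tau> i"
  by (simp add: play_eq_map_pos)

lemma last_play: "last (play \<sigma> \<tau> (Suc n)) = pos \<sigma> \<tau> n"
  by (simp add: play_eq_map_pos)

lemma captured_play_iff:
  "captured (play \<sigma> \<tau> n) \<longleftrightarrow> (\<exists>i. Suc i < n \<and> pos \<sigma> \<tau> i = pos \<sigma> \<tau> (Suc i))"
  by (auto simp: captured_def)

lemma captured_play_mono: "captured (play \<sigma> \<tau> m) \<Longrightarrow> m \<le> n \<Longrightarrow> captured (play \<sigma> \<tau> n)"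
  unfolding captured_play_iff by (meson less_le_trans)

lemma captured_play_Suc_Suc:
  "captured (play \<sigma> \<tau> (Suc (Suc n))) \<longleftrightarrow>
     captured (play \<sigma> \<tau> (Suc n)) \<or> pos \<sigma> \<tau> n = pos \<sigma> \<tau> (Suc n)"
  by (auto simp: captured_play_iff less_Suc_eq)

lemma legal_history_play_Suc:
  assumes "legal_history V E (play \<sigma> \<tau> n)" "pos \<sigma> \<tau> n \<in> available V E (play \<sigma> \<tau> n)"
  shows "legal_history V E (play \<sigma> \<tau> (Suc n))"
  unfolding legal_history_def
proof (intro conjI allI impI)
  show "set (play \<sigma> \<tau> (Suc n)) \<subseteq> V"
    using assms by (simp add: legal_history_def available_def play_eq_map_pos)
next
  fix i assume i: "i + 2 < length (play \<sigma> \<tau> (Suc n))"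
  show "(play \<sigma> \<tau> (Suc n) ! i, play \<sigma> \<tau> (Suc n) ! (i + 2)) \<in> E"
  proof (cases "i + 2 = n")
    case True
    then have "n - 2 = i" "i < n" by auto
    with True have "(pos \<sigma> \<tau> i, pos \<sigma> \<tau> n) \<in> E"
      using assms(2) by (auto simp: available_def)
    with True i show ?thesis
      by simp
  next
    case False
    with i have *: "i + 2 < n" by simp
    with assms(1) have "(play \<sigma> \<tau> n ! i, play \<sigma> \<tau> n ! (i + 2)) \<in> E"
      by (simp only: legal_history_def length_play)
    with * show ?thesis by simp
  qed
qed

text \<open>Strategies are constrained only at legal histories without capture, so legality is
  carried along the play by induction, each step feeding the next availability.\<close>

lemma legal_history_play:
  assumes "cop_strategy V E \<sigma>" "robber_strategy V E \<tau>" "\<not> captured (play \<sigma> \<tau> n)"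
  shows "legal_history V E (play \<sigma> \<tau> n)" "pos \<sigma> \<tau> n \<in> available V E (play \<sigma> \<tau> n)"
proof -
  have avail: "pos \<sigma> \<tau> k \<in> available V E (play \<sigma> \<tau> k)"
    if "legal_history V E (play \<sigma> \<tau> k)" "\<not> captured (play \<sigma> \<tau> k)" for k
    using that assms(1,2) by (auto simp: pos_def cop_strategy_def robber_strategy_def)
  show legal: "legal_history V E (play \<sigma> \<tau> n)"
    using assms(3)
  proof (induction n)
    case 0
    then show ?case by (simp add: legal_history_def)
  next
    case (Suc n)
    have "\<not> captured (play \<sigma> \<tau> n)"
      using Suc.prems captured_play_mono[of \<sigma> \<tau> n "Suc n"] by auto
    then show ?case
      using Suc.IH avail legal_history_play_Suc by blast
  qed
  show "pos \<sigma> \<tau> n \<in> available V E (play \<sigma> \<tau> n)"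
    using avail legal assms(3) by blast
qed

lemma pos_in_vertices:
  assumes "cop_strategy V E \<sigma>" "robber_strategy V E \<tau>" "\<not> captured (play \<sigma> \<tau> n)" "i \<le> n"
  shows "pos \<sigma> \<tau> i \<in> V"
proof -
  have "\<not> captured (play \<sigma> \<tau> i)"
    using assms(3,4) captured_play_mono by blast
  then show ?thesis
    using legal_history_play(2)[OF assms(1,2)] by (auto simp: available_def)
qed

lemma pos_adjacent:
  assumes "cop_strategy V E \<sigma>" "robber_strategy V E \<tau>" "\<not> captured (play \<sigma> \<tau> n)" "i + 2 \<le> n"
  shows "(pos \<sigma> \<tau> i, pos \<sigma> \<tau> (i + 2)) \<in> E"
proof -
  have "\<not> captured (play \<sigma> \<tau> (i + 2))"
    using assms(3,4) captured_play_mono by blast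
  then have "pos \<sigma> \<tau> (i + 2) \<in> available V E (play \<sigma> \<tau> (i + 2))"
    using legal_history_play(2)[OF assms(1,2)] by blast
  then show ?thesis
    by (auto simp: available_def)
qed


section \<open>Strict corners and stages\<close>

lemma strictly_corners_trans:
  assumes "strictly_corners E H w v" "strictly_corners E H x w"
  shows "strictly_corners E H x v"
  using assms unfolding strictly_corners_def corners_def by blast

text \<open>Among the vertices strictly cornering \<open>v\<close>, take one with the most
  neighbours in \<open>H\<close>: whatever strictly cornered it would, by transitivity, strictly
  corner \<open>v\<close> with even more neighbours. This is what keeps projections
  nonempty.\<close>

lemma ex_maximal_strict_corner:
  assumes "finite H" "v \<in> strict_corners E H"
  obtains w where "strictly_corners E H w v" "w \<in> H - strict_corners E H"
proof -
  let ?N = "\<lambda>w. {u \<in> H. (w, u) \<in> E}"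
  let ?W = "{w. strictly_corners E H w v}"
  let ?C = "(\<lambda>w. card (?N w)) ` ?W"
  have "?W \<subseteq> H" by (auto simp: strictly_corners_def corners_def)
  then have fin: "finite ?C" using assms(1) finite_subset by blast
  moreover have "?C \<noteq> {}" using assms(2) by (simp add: strict_corners_def)
  ultimately have "Max ?C \<in> ?C" by (rule Max_in)
  then obtain w where w: "w \<in> ?W" "card (?N w) = Max ?C" by (metis (no_types, lifting) imageE)
  have "w \<notin> strict_corners E H"
  proof
    assume "w \<in> strict_corners E H"
    then obtain x where x: "strictly_corners E H x w"
      by (auto simp: strict_corners_def)
    with w(1) have "x \<in> ?W" using strictly_corners_trans[of E H w v x] by simp
    moreover have "?N w \<subset> ?N x"
      using x by (auto simp: strictly_corners_def corners_def)
    then have "card (?N w) < card (?N x)"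
      using assms(1) by (intro psubset_card_mono) auto
    moreover from \<open>x \<in> ?W\<close> have "card (?N x) \<le> Max ?C"
      by (intro Max_ge fin imageI)
    ultimately show False using w(2) by simp
  qed
  with w(1) show thesis
    by (intro that[of w]) (auto simp: strictly_corners_def corners_def)
qed

text \<open>An empty stage encodes that the ranking has stopped, so a nonempty successor excludes
  both stopping cases.\<close>

lemma stage_Suc_nonempty:
  assumes "1 \<le> k" "stage V E (Suc k) \<noteq> {}"
  shows "\<not> is_clique E (stage V E k)"
    "stage V E (Suc k) = stage V E k - strict_corners E (stage V E k)"
  using assms by (cases k; auto simp: Let_def split: if_splits)+

lemma stage_mono:
  assumes "1 \<le> j" "j \<le> k"
  shows "stage V E k \<subseteq> stage V E j"
  using assms(2,1)
proof (induction k rule: dec_induct)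
  case base
  then show ?case by simp
next
  case (step n)
  then show ?case
    using stage_Suc_nonempty(2)[of n V E] by (cases "stage V E (Suc n) = {}") auto
qed

text \<open>The stage after \<open>j\<close> is either empty or has lost its strict corners, so a
  vertex ranked \<open>j\<close> never reappears. In particular its finite rank is unique.\<close>

lemma gets_rank_ge:
  assumes "v \<in> stage V E k" "gets_rank V E v j"
  shows "k \<le> j"
proof (rule ccontr)
  assume "\<not> k \<le> j"
  moreover have "1 \<le> j"
    using assms(2) by (cases j) (auto simp: gets_rank_def)
  ultimately have v: "v \<in> stage V E (Suc j)"
    using assms(1) stage_mono[of "Suc j" k V E] by auto
  then show False
    using stage_Suc_nonempty[of j V E] \<open>1 \<le> j\<close> assms(2) by (auto simp: gets_rank_def)
qed

section \<open>Ranks and stages when the corner rank is finite\<close>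

locale ranked_graph =
  fixes V :: "'a set" and E :: "('a \<times> 'a) set" and \<alpha> :: nat
  assumes graph: "reflexive_graph V E"
    and rank: "graph_corner_rank V E = enat \<alpha>"
    and rank_ge_2: "2 \<le> \<alpha>"
begin

abbreviation "G \<equiv> stage V E"
abbreviation "F k v \<equiv> proj V E k {v}"
abbreviation "m \<equiv> \<alpha> - win_type V E \<alpha>"

lemma finite_V: "finite V" and V_nonempty: "V \<noteq> {}"
  using graph by (auto simp: reflexive_graph_def)

lemma adj_refl: "v \<in> V \<Longrightarrow> (v, v) \<in> E"
  using graph by (auto simp: reflexive_graph_def)

lemma adj_sym: "(u, v) \<in> E \<Longrightarrow> (v, u) \<in> E"
  using graph by (auto simp: reflexive_graph_def sym_def)

lemma stage_subset: "G k \<subseteq> V"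
  using stage_mono[of 1 k V E] by (cases k) auto

lemma finite_stage: "finite (G k)"
  using stage_subset finite_V finite_subset by blast

lemma corner_rank_le:
  assumes "v \<in> V"
  shows "corner_rank V E v \<le> enat \<alpha>"
  using assms rank finite_V Max_ge[of "corner_rank V E ` V" "corner_rank V E v"]
  by (simp add: graph_corner_rank_def)

lemma finite_corner_rank:
  assumes "v \<in> V"
  obtains j where "corner_rank V E v = enat j" "gets_rank V E v j"
proof -
  have ex: "\<exists>j. gets_rank V E v j"
  proof (rule ccontr)
    assume "\<nexists>j. gets_rank V E v j"
    then have "corner_rank V E v = \<infinity>" by (simp add: corner_rank_def)
    then show False using corner_rank_le[OF assms] by simp
  qed
  then have "gets_rank V E v (LEAST j. gets_rank V E v j)"
    by (rule LeastI_ex)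
  with ex show thesis by (intro that) (auto simp: corner_rank_def)
qed

text \<open>The dictionary between ranks and stages: a vertex lies in the stage of its rank, stages
  decrease, and it lies in no later one.\<close>

lemma le_corner_rank_iff:
  assumes "v \<in> V" "1 \<le> k"
  shows "enat k \<le> corner_rank V E v \<longleftrightarrow> v \<in> G k"
proof -
  obtain j where cr: "corner_rank V E v = enat j" and j: "gets_rank V E v j"
    using finite_corner_rank[OF assms(1)] .
  then have "v \<in> G j" by (simp add: gets_rank_def)
  with j show ?thesis
    using stage_mono[of k j V E] gets_rank_ge[of v V E k j] assms(2) by (auto simp: cr)
qed

lemma stage_top_nonempty: "G \<alpha> \<noteq> {}"
proof -
  have "Max (corner_rank V E ` V) \<in> corner_rank V E ` V"
    using finite_V V_nonempty by (intro Max_in) auto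
  then obtain v where "v \<in> V" "corner_rank V E v = enat \<alpha>"
    using rank by (auto simp: graph_corner_rank_def)
  then have "v \<in> G \<alpha>"
    using le_corner_rank_iff[of v \<alpha>] rank_ge_2 by auto
  then show ?thesis by blast
qed

lemma stage_nonempty:
  assumes "1 \<le> k" "k \<le> \<alpha>"
  shows "G k \<noteq> {}"
  using stage_mono[OF assms, of V E] stage_top_nonempty by blast

lemma corner_rank_top: "v \<in> G \<alpha> \<Longrightarrow> corner_rank V E v = enat \<alpha>"
  using corner_rank_le[of v] le_corner_rank_iff[of v \<alpha>] stage_subset rank_ge_2
  by (auto intro: antisym)

lemma stage_beyond_top:
  assumes "\<alpha> < k"
  shows "G k = {}"
proof -
  have False if v: "v \<in> G k" for v
  proof -
    have "v \<in> V" using v stage_subset by blast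
    then have "enat k \<le> corner_rank V E v"
      using v assms le_corner_rank_iff[of v k] by simp
    also have "\<dots> \<le> enat \<alpha>" using corner_rank_le \<open>v \<in> V\<close> by blast
    finally show False using assms by simp
  qed
  then show ?thesis by blast
qed

lemma stage_Suc:
  assumes "1 \<le> k" "k < \<alpha>"
  shows "\<not> is_clique E (G k)" "G (Suc k) = G k - strict_corners E (G k)"
  using stage_Suc_nonempty[OF assms(1), of V E] stage_nonempty[of "Suc k"] assms by auto

text \<open>Otherwise every vertex of the top stage, having rank exactly \<alpha>, would be a strict
  corner there; but a strict corner is always strictly cornered by some vertex that is not
  one.\<close>

lemma stage_top_clique: "is_clique E (G \<alpha>)"
proof (rule ccontr)
  assume nc: "\<not> is_clique E (G \<alpha>)"
  have "v \<in> strict_corners E (G \<alpha>)" if v: "v \<in> G \<alpha>" for v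
  proof -
    have "v \<in> V" using v stage_subset by blast
    then have "gets_rank V E v \<alpha>"
      using finite_corner_rank[of v] corner_rank_top[OF v] by (metis enat.inject)
    with nc show ?thesis by (simp add: gets_rank_def)
  qed
  then show False
    using ex_maximal_strict_corner[OF finite_stage, of _ E \<alpha>] stage_top_nonempty by blast
qed


section \<open>Projections\<close>

lemma proj_Suc:
  assumes "1 \<le> k"
  shows "F (Suc k) v = (\<Union>u\<in>F k v. proj_step V E k {u})"
  using assms by (cases k) (auto simp: proj_step_def)

text \<open>A surviving vertex projects to itself, which is covered by the degenerate case of
  \<open>corners\<close>; a strict corner projects to vertices cornering it.\<close>

lemma proj_step_subset:
  assumes "1 \<le> k" "k < \<alpha>" "u \<in> G k" "w \<in> proj_step V E k {u}"
  shows "w \<in> G (Suc k)" "corners E (G k) w u"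
proof -
  have "u \<in> V" using assms(3) stage_subset by blast
  then have *: "enat k < corner_rank V E u \<longleftrightarrow> u \<in> G (Suc k)"
    using le_corner_rank_iff[of u "Suc k"] by (simp add: Suc_ile_eq)
  show "w \<in> G (Suc k)" "corners E (G k) w u"
    using assms * by (auto simp: proj_step_def strictly_corners_def corners_def split: if_splits)
qed

lemma proj_step_nonempty:
  assumes "1 \<le> k" "k < \<alpha>" "u \<in> G k"
  shows "proj_step V E k {u} \<noteq> {}"
proof (cases "u \<in> G (Suc k)")
  case True
  moreover have "u \<in> V" using assms(3) stage_subset by blast
  ultimately have "enat k < corner_rank V E u"
    using le_corner_rank_iff[of u "Suc k"] by (simp add: Suc_ile_eq)
  then show ?thesis by (simp add: proj_step_def)
next
  case False
  with assms have "u \<in> strict_corners E (G k)" by (simp add: stage_Suc)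
  then obtain w where "strictly_corners E (G k) w u" "w \<in> G (Suc k)"
    using ex_maximal_strict_corner[OF finite_stage] assms stage_Suc by metis
  then show ?thesis by (auto simp: proj_step_def)
qed

lemma proj_stage:
  assumes "1 \<le> k" "k \<le> \<alpha>" "v \<in> V"
  shows "F k v \<noteq> {} \<and> F k v \<subseteq> G k"
  using assms(1,2)
proof (induction k rule: dec_induct)
  case base
  then show ?case using assms(3) by simp
next
  case (step n)
  then have n: "1 \<le> n" "n < \<alpha>" and IH: "F n v \<noteq> {}" "F n v \<subseteq> G n" by auto
  have "proj_step V E n {u} \<noteq> {} \<and> proj_step V E n {u} \<subseteq> G (Suc n)" if "u \<in> F n v" for u
    using that IH proj_step_nonempty[OF n] proj_step_subset(1)[OF n] by blast
  with IH(1) show ?case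
    unfolding proj_Suc[OF n(1)] by blast
qed

lemma proj_fixes_stage:
  assumes "1 \<le> k" "v \<in> G k"
  shows "F k v = {v}"
  using assms
proof (induction k rule: dec_induct)
  case base
  then show ?case by simp
next
  case (step n)
  have v: "v \<in> G n" using step.prems step.hyps stage_mono[of n "Suc n" V E] by auto
  have "v \<in> V" using v stage_subset by blast
  then have "enat n < corner_rank V E v"
    using le_corner_rank_iff[of v "Suc n"] step.prems by (simp add: Suc_ile_eq)
  then show ?case
    using step.IH[OF v] step.hyps by (simp add: proj_Suc proj_step_def)
qed

lemma proj_Suc_corners:
  assumes "1 \<le> k" "k < \<alpha>" "v \<in> V" "w \<in> F (Suc k) v"
  obtains u where "u \<in> F k v" "corners E (G k) w u"
proof -
  obtain u where u: "u \<in> F k v" "w \<in> proj_step V E k {u}"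
    using assms proj_Suc by auto
  moreover have "u \<in> G k" using u(1) proj_stage[of k v] assms by auto
  ultimately show thesis
    using that proj_step_subset(2)[of k u w] assms by blast
qed

text \<open>Adjacency is lifted one side at a time: \<open>c'\<close> inherits the neighbour
  \<open>d2\<close> from the vertex it corners, and by symmetry \<open>d'\<close> then inherits the
  neighbour \<open>c'\<close>.\<close>

lemma proj_adjacent:
  assumes "1 \<le> k" "k \<le> \<alpha>" "c \<in> V" "d \<in> V" "(c, d) \<in> E" "c' \<in> F k c" "d' \<in> F k d"
  shows "(c', d') \<in> E"
  using assms(1,2,6,7)
proof (induction k arbitrary: c' d' rule: dec_induct)
  case base
  then show ?case using assms(5) by simp
next
  case (step n)
  then have n: "1 \<le> n" "n < \<alpha>" "n \<le> \<alpha>" by auto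
  obtain c2 where c2: "c2 \<in> F n c" "corners E (G n) c' c2"
    using proj_Suc_corners[OF n(1,2) assms(3)] step.prems by blast
  obtain d2 where d2: "d2 \<in> F n d" "corners E (G n) d' d2"
    using proj_Suc_corners[OF n(1,2) assms(4)] step.prems by blast
  have "(c2, d2) \<in> E" using step.IH c2 d2 n by blast
  with c2 d2 have "(c', d2) \<in> E" by (auto simp: corners_def)
  then have "(d2, c') \<in> E" by (rule adj_sym)
  with c2 d2 have "(d', c') \<in> E" by (auto simp: corners_def)
  then show ?case by (rule adj_sym)
qed

text \<open>Projecting one side a single stage further keeps adjacency. This offset matches one
  round of play, in which the stage index drops by one; both players' arguments rest on it.\<close>

lemma proj_Suc_adjacent:
  assumes "1 \<le> k" "k < \<alpha>" "c \<in> V" "d \<in> V" "(c, d) \<in> E" "c' \<in> F (Suc k) c" "d' \<in> F k d"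
  shows "(c', d') \<in> E"
proof -
  obtain u where u: "u \<in> F k c" "corners E (G k) c' u"
    using proj_Suc_corners assms by blast
  have "(u, d') \<in> E" using proj_adjacent[of k c d u d'] u assms by auto
  moreover have "d' \<in> G k" using proj_stage[of k d] assms by auto
  ultimately show ?thesis using u by (auto simp: corners_def)
qed


section \<open>Dominating vertices\<close>

lemma m_bounds: "1 \<le> m" "m \<le> \<alpha>"
  using rank_ge_2 by (auto simp: win_type_def)

text \<open>For \<open>r = 0\<close> any vertex of the top clique serves; for \<open>r = 1\<close>
  the witness in \<open>win_type\<close> does.\<close>

lemma ex_standard_placement: "\<exists>c. standard_placement V E \<alpha> c"
proof (cases "win_type V E \<alpha> = 0")
  case True
  obtain c where c: "c \<in> G \<alpha>" using stage_top_nonempty by blast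
  then have "c \<in> V" using stage_subset by blast
  with True c show ?thesis
    using stage_top_clique by (auto simp: standard_placement_def is_clique_def)
next
  case False
  then have win: "win_type V E \<alpha> = 1" by (simp add: win_type_def split: if_splits)
  have "\<exists>v\<in>V. corner_rank V E v = enat \<alpha> \<and> (\<forall>u\<in>G (\<alpha> - 1). (v, u) \<in> E)"
    using False unfolding win_type_def by argo
  then show ?thesis unfolding standard_placement_def win by blast
qed

text \<open>A dominating \<open>d\<close> strictly corners every non-dominating vertex of
  \<open>G k\<close>, so the next stage contains only dominating vertices and is a clique. Hence it
  is the top stage, \<open>d\<close> has rank \<alpha>, and the graph is 1-cop-win, which gives
  \<open>m = k\<close>.\<close>

lemma no_dominating_vertex:
  assumes "1 \<le> k" "k < m" "d \<in> G k"
  shows "\<exists>x\<in>G k. (d, x) \<notin> E"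
proof (rule ccontr)
  assume "\<not> ?thesis"
  then have dom: "(d, x) \<in> E" if "x \<in> G k" for x using that by blast
  have k: "1 \<le> k" "k < \<alpha>" using assms m_bounds by auto
  \<comment> \<open>A dominating vertex cannot be strictly cornered: nothing has a neighbour that it
    lacks.\<close>
  have d: "d \<in> G (Suc k)"
    using stage_Suc[OF k] assms(3) dom by (auto simp: strict_corners_def strictly_corners_def)
  have "(u, x) \<in> E" if u: "u \<in> G (Suc k)" and x: "x \<in> G k" for u x
  proof (rule ccontr)
    assume nadj: "(u, x) \<notin> E"
    have "u \<in> G k" using u k stage_Suc by auto
    then have "strictly_corners E (G k) d u"
      using nadj x dom assms(3) by (auto simp: strictly_corners_def corners_def)
    then have "u \<in> strict_corners E (G k)" by (auto simp: strict_corners_def)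
    with u k show False using stage_Suc by auto
  qed
  then have "is_clique E (G (Suc k))"
    using k stage_Suc by (auto simp: is_clique_def)
  then have "\<not> Suc k < \<alpha>" using stage_Suc(1)[of "Suc k"] by auto
  with k have \<alpha>: "\<alpha> = Suc k" by simp
  with d have "corner_rank V E d = enat \<alpha>" "d \<in> V"
    using corner_rank_top stage_subset by auto
  then have "win_type V E \<alpha> = 1"
    using dom \<alpha> by (auto simp: win_type_def)
  with \<alpha> assms show False by simp
qed


section \<open>The cop wins within \<open>m\<close> moves\<close>

text \<open>The \<open>t\<close>-th cop move takes place at a history of length \<open>2 t\<close>, hence projects to stage
  \<open>m + 1 - t\<close>.\<close>

definition proj_cop :: "'a list \<Rightarrow> 'a" where
  "proj_cop h =
     (if h = [] then SOME c. standard_placement V E \<alpha> c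
      else if \<exists>d. d \<in> F (m + 1 - length h div 2) (last h) \<inter> available V E h
      then SOME d. d \<in> F (m + 1 - length h div 2) (last h) \<inter> available V E h
      else h ! (length h - 2))"

lemma standard_placement_proj_cop: "standard_placement V E \<alpha> (proj_cop [])"
  using ex_standard_placement by (simp add: proj_cop_def someI_ex)

text \<open>Staying is the default move of \<open>proj_cop\<close>, and later the robber's way to
  avoid the cop.\<close>

lemma stay_available:
  assumes "legal_history V E h" "2 \<le> length h"
  shows "h ! (length h - 2) \<in> available V E h"
proof -
  have "h ! (length h - 2) \<in> set h" using assms(2) by (intro nth_mem) auto
  then show ?thesis
    using assms(1) adj_refl by (auto simp: legal_history_def available_def)
qed

lemma proj_cop_strategy: "cop_strategy V E proj_cop"
  unfolding cop_strategy_def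
proof (intro allI impI)
  fix h assume h: "legal_history V E h \<and> \<not> captured h \<and> even (length h)"
  let ?S = "F (m + 1 - length h div 2) (last h) \<inter> available V E h"
  show "proj_cop h \<in> available V E h"
  proof (cases "h = []")
    case True
    then show ?thesis
      using standard_placement_proj_cop by (simp add: available_def standard_placement_def)
  next
    case False
    with h have "2 \<le> length h" by (cases h; cases "tl h") auto
    then have stay: "h ! (length h - 2) \<in> available V E h"
      using h stay_available by blast
    have "(SOME d. d \<in> ?S) \<in> ?S" if "\<exists>d. d \<in> ?S"
      using that by (rule someI_ex)
    with stay show ?thesis
      using False by (auto simp: proj_cop_def)
  qed
qed

lemma proj_cop_pos:
  assumes \<tau>: "robber_strategy V E \<tau>" and t: "1 \<le> t" "t \<le> m"
    and nc: "\<not> captured (play proj_cop \<tau> (2 * t))"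
  shows "pos proj_cop \<tau> (2 * t) \<in> F (m + 1 - t) (pos proj_cop \<tau> (2 * t - 1))"
  using t nc
proof (induction t rule: dec_induct)
  case base
  let ?p = "pos proj_cop \<tau>" and ?h = "play proj_cop \<tau> 2"
  have nc: "\<not> captured ?h" using base by simp
  have V: "?p i \<in> V" if "i \<le> 2" for i
    using pos_in_vertices[OF proj_cop_strategy \<tau> nc that] .
  have p0: "?p 0 = proj_cop []" by (simp add: pos_def)
  have last: "last ?h = ?p 1"
    using last_play[of proj_cop \<tau> 1] by (simp add: numeral_2_eq_2)
  obtain d where d: "d \<in> F m (?p 1)" "d \<in> G m"
    using proj_stage[OF m_bounds V[of 1]] by auto
  then have "(?p 0, d) \<in> E"
    using standard_placement_proj_cop p0 by (simp add: standard_placement_def)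
  moreover have "d \<in> V" using d stage_subset by blast
  ultimately have "d \<in> available V E ?h"
    by (simp add: available_def del: play.simps)
  with d have ex: "\<exists>d. d \<in> F (m + 1 - length ?h div 2) (last ?h) \<inter> available V E ?h"
    using last by auto
  have "?h \<noteq> []" by simp
  with ex have "proj_cop ?h \<in> F (m + 1 - length ?h div 2) (last ?h)"
    using someI_ex[OF ex] by (simp only: proj_cop_def if_False if_True) blast
  then show ?case
    using last by (simp add: pos_def)
next
  case (step t)
  let ?p = "pos proj_cop \<tau>" and ?h = "play proj_cop \<tau> (2 * Suc t)"
  define k where "k = m - t"
  have k: "1 \<le> k" "k < \<alpha>" "m + 1 - t = Suc k" "m + 1 - Suc t = k"
    using step.prems step.hyps m_bounds unfolding k_def by linarith+
  have nc: "\<not> captured ?h" using step.prems by simp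
  have V: "?p i \<in> V" if "i \<le> 2 * Suc t" for i
    using pos_in_vertices[OF proj_cop_strategy \<tau> nc that] .
  have "2 * t - 1 + 2 = 2 * t + 1" using step.hyps by simp
  then have adj: "(?p (2 * t - 1), ?p (2 * t + 1)) \<in> E"
    using pos_adjacent[OF proj_cop_strategy \<tau> nc, of "2 * t - 1"] by simp
  have last: "last ?h = ?p (2 * t + 1)"
    using last_play[of proj_cop \<tau> "2 * t + 1"] by simp
  have "\<not> captured (play proj_cop \<tau> (2 * t))"
    using nc captured_play_mono[of proj_cop \<tau> "2 * t" "2 * Suc t"] by auto
  then have IH: "?p (2 * t) \<in> F (Suc k) (?p (2 * t - 1))"
    using step.IH step.prems k by simp
  obtain d where d: "d \<in> F k (?p (2 * t + 1))" "d \<in> G k"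
    using proj_stage[of k "?p (2 * t + 1)"] k V by auto
  then have "(?p (2 * t), d) \<in> E"
    using proj_Suc_adjacent[OF k(1,2) V V adj IH] by auto
  moreover have "d \<in> V" using d stage_subset by blast
  ultimately have "d \<in> available V E ?h"
    by (simp add: available_def del: play.simps)
  with d have ex: "\<exists>d. d \<in> F (m + 1 - length ?h div 2) (last ?h) \<inter> available V E ?h"
    using last k by auto
  have "?h \<noteq> []" by simp
  with ex have "proj_cop ?h \<in> F (m + 1 - length ?h div 2) (last ?h)"
    using someI_ex[OF ex] by (simp only: proj_cop_def if_False if_True) blast
  then show ?case
    using last by (simp add: pos_def)
qed

text \<open>The final position only has to be examined when no capture has happened earlier.\<close>

lemma captured_within_if_last_move_captures:
  assumes "1 \<le> t"
    and "\<not> captured (play \<sigma> \<tau> (2 * t)) \<Longrightarrow> pos \<sigma> \<tau> (2 * t) = pos \<sigma> \<tau> (2 * t - 1)"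
  shows "captured_within t \<sigma> \<tau>"
proof (cases "captured (play \<sigma> \<tau> (2 * t))")
  case True
  then show ?thesis
    using captured_play_mono[of \<sigma> \<tau> "2 * t" "2 * t + 2"] by (simp add: captured_within_def)
next
  case False
  then have "pos \<sigma> \<tau> (2 * t - 1) = pos \<sigma> \<tau> (Suc (2 * t - 1))"
    using assms by simp
  then show ?thesis
    using assms(1) unfolding captured_within_def captured_play_iff
    by (intro exI[of _ "2 * t - 1"]) simp
qed

lemma proj_cop_wins: "wins_within V E m proj_cop"
  unfolding wins_within_def
proof (intro allI impI)
  fix \<tau> assume "robber_strategy V E \<tau>"
  then show "captured_within m proj_cop \<tau>"
    \<comment> \<open>At \<open>t = m\<close> the projection index is 1, where \<open>F\<close> is
      the identity, so the cop lands on the robber.\<close>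
    using proj_cop_pos[of \<tau> m] m_bounds by (intro captured_within_if_last_move_captures) auto
qed

lemma lower_way_wins:
  assumes "lower_way V E \<alpha> \<sigma>"
  shows "wins_within V E m \<sigma>"
  unfolding wins_within_def
proof (intro allI impI)
  fix \<tau> assume \<tau>: "robber_strategy V E \<tau>"
  show "captured_within m \<sigma> \<tau>"
  proof (rule captured_within_if_last_move_captures)
    assume "\<not> captured (play \<sigma> \<tau> (2 * m))"
    then obtain k where "k + win_type V E \<alpha> + m \<le> \<alpha>"
      "k_cornered V E k (\<sigma> (play \<sigma> \<tau> (2 * m))) (last (play \<sigma> \<tau> (2 * m)))"
      using assms \<tau> m_bounds unfolding lower_way_def Let_def by blast
    \<comment> \<open>With \<open>t = m\<close> the bound leaves no room for a positive
      \<open>k\<close>, and being 0-cornered is capture.\<close>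
    moreover from this have "k = 0" using m_bounds by linarith
    ultimately have "\<sigma> (play \<sigma> \<tau> (2 * m)) = last (play \<sigma> \<tau> (2 * m))"
      by (simp add: k_cornered_def)
    moreover have "last (play \<sigma> \<tau> (2 * m)) = pos \<sigma> \<tau> (2 * m - 1)"
      using last_play[of \<sigma> \<tau> "2 * m - 1"] m_bounds by simp
    ultimately show "pos \<sigma> \<tau> (2 * m) = pos \<sigma> \<tau> (2 * m - 1)"
      by (simp add: pos_def)
  qed (rule m_bounds)
qed


section \<open>The robber survives \<open>m - 1\<close> moves\<close>

lemma proj_safe_iff:
  "proj_safe V E k c x \<longleftrightarrow> 1 \<le> k \<and> x \<in> G k \<and> (\<exists>c'\<in>F k c. (c', x) \<notin> E)"
  using le_corner_rank_iff[of x k] stage_subset[of k] by (auto simp: proj_safe_def)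

lemma proj_safe_le: "proj_safe V E k c x \<Longrightarrow> k \<le> \<alpha>"
  using stage_beyond_top[of k] by (auto simp: proj_safe_iff not_le[symmetric])

text \<open>Since \<open>x\<close> lies in \<open>G k\<close> it is its own projection, so an edge
  from \<open>c\<close> to \<open>x\<close> would project to an edge from every \<open>c'\<close> to
  \<open>x\<close>.\<close>

lemma proj_safe_not_adjacent:
  assumes "c \<in> V" "proj_safe V E k c x"
  shows "(c, x) \<notin> E"
proof
  assume adj: "(c, x) \<in> E"
  obtain c' where *: "1 \<le> k" "x \<in> G k" "c' \<in> F k c" "(c', x) \<notin> E"
    using assms(2) by (auto simp: proj_safe_iff)
  moreover have "x \<in> V" using * stage_subset by blast
  ultimately show False
    using proj_adjacent[of k c x c' x] adj assms proj_safe_le proj_fixes_stage by auto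
qed

lemma proj_safe_not_equal: "c \<in> V \<Longrightarrow> proj_safe V E k c x \<Longrightarrow> x \<noteq> c"
  using proj_safe_not_adjacent adj_refl by blast

text \<open>A projection of the cop's vertex lies in \<open>G k\<close> and cannot dominate
  it.\<close>

lemma ex_proj_safe_start:
  assumes "1 \<le> k" "k < m" "c \<in> V"
  shows "\<exists>x\<in>V. proj_safe V E k c x"
proof -
  obtain c' where c': "c' \<in> F k c" "c' \<in> G k"
    using proj_stage[of k c] assms m_bounds by auto
  then obtain x where "x \<in> G k" "(c', x) \<notin> E"
    using no_dominating_vertex assms by blast
  with c' assms stage_subset show ?thesis by (auto simp: proj_safe_iff)
qed

text \<open>If the cop's new projection \<open>d'\<close> cornered \<open>x\<close> in \<open>G\<^sub>k\<close>, then, \<open>x\<close> not being a strict corner,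
  \<open>d'\<close> and \<open>x\<close> would have the same neighbours in \<open>G\<^sub>k\<close>, among them \<open>c'\<close>.\<close>

lemma ex_proj_safe_move:
  assumes safe: "proj_safe V E (Suc k) c x" and k: "1 \<le> k"
    and cd: "c \<in> V" "d \<in> V" "(c, d) \<in> E"
  shows "\<exists>y\<in>V. (x, y) \<in> E \<and> proj_safe V E k d y"
proof -
  obtain c' where x: "x \<in> G (Suc k)" and c': "c' \<in> F (Suc k) c" "(c', x) \<notin> E"
    using safe by (auto simp: proj_safe_iff)
  have k_less: "k < \<alpha>" using proj_safe_le[OF safe] by simp
  obtain d' where d': "d' \<in> F k d" "d' \<in> G k"
    using proj_stage[of k d] k k_less cd by auto
  have c'd': "(c', d') \<in> E"
    using proj_Suc_adjacent[OF k k_less cd c'(1) d'(1)] .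
  have xk: "x \<in> G k" "x \<notin> strict_corners E (G k)"
    using x stage_Suc[OF k k_less] by auto
  have "c' \<in> G k"
    using c'(1) proj_stage[of "Suc k" c] cd k_less stage_Suc[OF k k_less] by auto
  have "\<not> corners E (G k) d' x"
  proof
    assume cor: "corners E (G k) d' x"
    have "d' \<noteq> x" using c' c'd' by blast
    moreover have "(d', c') \<in> E" "(x, c') \<notin> E"
      using c'd' c' adj_sym by blast+
    ultimately have "strictly_corners E (G k) d' x"
      using cor \<open>c' \<in> G k\<close> by (auto simp: strictly_corners_def)
    with xk show False by (auto simp: strict_corners_def)
  qed
  then obtain y where "y \<in> G k" "(x, y) \<in> E" "(d', y) \<notin> E"
    using d' xk by (auto simp: corners_def)
  with d' k stage_subset show ?thesis by (auto simp: proj_safe_iff)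
qed

section \<open>Higher Way choices and their existence\<close>

lemma higher_way_choice_not_equal:
  assumes "higher_way_choice V E A c x" "c \<in> V"
  shows "x \<noteq> c"
  using assms proj_safe_not_equal by (auto simp: higher_way_choice_def split: if_splits)

text \<open>Maximality of the chosen level turns any reachable safe vertex into a lower bound for
  it.\<close>

lemma higher_way_choice_safe:
  assumes "higher_way_choice V E A c x" "y \<in> A" "proj_safe V E j c y"
  shows "\<exists>k\<ge>j. proj_safe V E k c x"
proof -
  have "\<exists>k. \<exists>y\<in>A. proj_safe V E k c y" using assms by blast
  with assms show ?thesis by (auto simp: higher_way_choice_def)
qed

text \<open>Safety levels are bounded by \<alpha>, so a greatest one is attained; \<open>z\<close>
  serves the case without safe vertices.\<close>

lemma ex_higher_way_choice:
  assumes "z \<in> A" "z \<noteq> c"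
  shows "\<exists>x. higher_way_choice V E A c x"
proof (cases "\<exists>k. \<exists>y\<in>A. proj_safe V E k c y")
  case True
  let ?P = "\<lambda>k. \<exists>y\<in>A. proj_safe V E k c y"
  have bound: "\<And>k. ?P k \<Longrightarrow> k \<le> \<alpha>" using proj_safe_le by blast
  define k where "k = (GREATEST k. ?P k)"
  have "?P k" unfolding k_def by (rule GreatestI_ex_nat[of ?P, OF True bound])
  then obtain x where x: "x \<in> A" "proj_safe V E k c x" by blast
  have "j \<le> k" if "y \<in> A" "proj_safe V E j c y" for j y
    unfolding k_def by (rule Greatest_le_nat[of ?P j \<alpha>]) (use that bound in blast)+
  with x True show ?thesis unfolding higher_way_choice_def by auto
next
  case False
  with assms show ?thesis by (auto simp: higher_way_choice_def)
qed

lemma ex_other_vertex: "\<exists>z\<in>V. z \<noteq> c"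
proof (rule ccontr)
  assume "\<not> ?thesis"
  then have "V = {c}" using V_nonempty by auto
  then have "is_clique E (G 1)" using adj_refl by (simp add: is_clique_def)
  then show False using stage_Suc(1)[of 1] rank_ge_2 by auto
qed

lemma ex_available_other:
  assumes "legal_history V E h" "\<not> captured h" "odd (length h)"
  shows "\<exists>z\<in>available V E h. z \<noteq> last h"
proof (cases "2 \<le> length h")
  case True
  then have "h \<noteq> []" "Suc (length h - 2) = length h - 1" by auto
  \<comment> \<open>These are the robber's current vertex and the cop's; they differ because no
    capture has occurred, so the robber may stay.\<close>
  then have "h ! (length h - 2) \<noteq> last h"
    using assms(2) by (auto simp: captured_def last_conv_nth dest: spec[of _ "length h - 2"])
  with True assms(1) stay_available show ?thesis by blast
next
  case False
  then show ?thesis using ex_other_vertex by (auto simp: available_def)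
qed

text \<open>Existence matters for the lower bound on \<open>capt\<close>, which pits an arbitrary
  winning cop strategy against one such robber.\<close>

lemma ex_higher_way: "\<exists>\<tau>. higher_way V E \<tau>"
proof -
  define \<tau> where "\<tau> h = (SOME x. higher_way_choice V E (available V E h) (last h) x)" for h
  have choice: "higher_way_choice V E (available V E h) (last h) (\<tau> h)"
    if "legal_history V E h" "\<not> captured h" "odd (length h)" for h
    unfolding \<tau>_def using ex_available_other[OF that] ex_higher_way_choice by (metis someI_ex)
  have strat: "robber_strategy V E \<tau>"
    unfolding robber_strategy_def using choice by (auto simp: higher_way_choice_def)
  have "higher_way_choice V E (available V E (play \<sigma> \<tau> (2 * t + 1)))
          (last (play \<sigma> \<tau> (2 * t + 1))) (\<tau> (play \<sigma> \<tau> (2 * t + 1)))"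
    if "cop_strategy V E \<sigma>" "\<not> captured (play \<sigma> \<tau> (2 * t + 1))" for \<sigma> t
    using choice legal_history_play(1)[OF that(1) strat that(2)] that(2)
    by simp
  with strat show ?thesis unfolding higher_way_def Let_def by blast
qed

text \<open>The invariant loses one safety level per round. It is guarded by
  \<open>t + 1 < m\<close> because level 0 is meaningless; in the last round only the absence of
  capture remains.\<close>

lemma higher_way_survives:
  assumes \<tau>: "higher_way V E \<tau>" and \<sigma>: "cop_strategy V E \<sigma>" and t: "t < m"
  shows "\<not> captured (play \<sigma> \<tau> (2 * t + 2)) \<and>
    (t + 1 < m \<longrightarrow> (\<exists>k\<ge>m - 1 - t. proj_safe V E k (pos \<sigma> \<tau> (2 * t)) (pos \<sigma> \<tau> (2 * t + 1))))"
  using t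
proof (induction t)
  case 0
  let ?p = "pos \<sigma> \<tau>"
  have \<tau>s: "robber_strategy V E \<tau>" using \<tau> by (simp add: higher_way_def)
  have nc: "\<not> captured (play \<sigma> \<tau> 1)" by (simp add: captured_def)
  have V: "?p 0 \<in> V" using pos_in_vertices[OF \<sigma> \<tau>s nc, of 0] by simp
  have "higher_way_choice V E (available V E (play \<sigma> \<tau> 1)) (last (play \<sigma> \<tau> 1)) (\<tau> (play \<sigma> \<tau> 1))"
    using \<tau> \<sigma> nc unfolding higher_way_def Let_def by (metis One_nat_def add_0 mult_0_right)
  moreover have "available V E (play \<sigma> \<tau> 1) = V" by (auto simp: available_def)
  moreover have "last (play \<sigma> \<tau> 1) = ?p 0" "\<tau> (play \<sigma> \<tau> 1) = ?p 1"
    using last_play[of \<sigma> \<tau> 0] by (simp_all add: pos_def)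
  ultimately have choice: "higher_way_choice V E V (?p 0) (?p 1)"
    by simp
  have "?p 1 \<noteq> ?p 0" using higher_way_choice_not_equal[OF choice V] .
  then have "\<not> captured (play \<sigma> \<tau> (2 * 0 + 2))"
    by (auto simp: captured_play_iff less_Suc_eq)
  moreover have "\<exists>k\<ge>m - 1. proj_safe V E k (?p 0) (?p 1)" if "1 < m"
  proof -
    have "1 \<le> m - 1" "m - 1 < m" using that by linarith+
    then obtain x where "x \<in> V" "proj_safe V E (m - 1) (?p 0) x"
      using ex_proj_safe_start V by blast
    then show ?thesis using higher_way_choice_safe[OF choice] by blast
  qed
  ultimately show ?case by simp
next
  case (Suc t)
  let ?p = "pos \<sigma> \<tau>" and ?h = "play \<sigma> \<tau> (2 * Suc t + 1)"
  have \<tau>s: "robber_strategy V E \<tau>" using \<tau> by (simp add: higher_way_def)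
  obtain k where IH: "\<not> captured (play \<sigma> \<tau> (2 * t + 2))" "m - 1 - t \<le> k"
      "proj_safe V E k (?p (2 * t)) (?p (2 * t + 1))"
    using Suc by auto
  have adj: "(?p (2 * t), ?p (2 * t + 2)) \<in> E"
    using pos_adjacent[OF \<sigma> \<tau>s IH(1), of "2 * t"] by simp
  have V: "?p i \<in> V" if "i \<le> 2 * t + 2" for i
    using pos_in_vertices[OF \<sigma> \<tau>s IH(1) that] .
  \<comment> \<open>Safety before the cop's move means that his move cannot reach the
    robber.\<close>
  have "?p (2 * t + 1) \<noteq> ?p (2 * t + 2)"
    using adj proj_safe_not_adjacent[OF V IH(3)] by auto
  then have nc: "\<not> captured ?h"
    using IH(1) captured_play_Suc_Suc[of \<sigma> \<tau> "2 * t + 1"] by simp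
  have "higher_way_choice V E (available V E ?h) (last ?h) (\<tau> ?h)"
    using \<tau> \<sigma> nc unfolding higher_way_def Let_def by blast
  moreover have "last ?h = ?p (2 * t + 2)"
    using last_play[of \<sigma> \<tau> "2 * t + 2"] by simp
  moreover have "\<tau> ?h = ?p (2 * t + 3)"
    by (simp add: pos_def numeral_3_eq_3)
  ultimately have choice: "higher_way_choice V E (available V E ?h) (?p (2 * t + 2)) (?p (2 * t + 3))"
    by simp
  have "?p (2 * t + 3) \<noteq> ?p (2 * t + 2)"
    using higher_way_choice_not_equal[OF choice] V by simp
  then have "\<not> captured (play \<sigma> \<tau> (2 * Suc t + 2))"
    using nc captured_play_Suc_Suc[of \<sigma> \<tau> "2 * t + 2"] by (simp add: numeral_3_eq_3)
  moreover have "\<exists>j\<ge>m - 1 - Suc t. proj_safe V E j (?p (2 * t + 2)) (?p (2 * t + 3))"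
    if "Suc t + 1 < m"
  proof -
    \<comment> \<open>The cop's move costs one level; the guard gives \<open>k\<close> at least 2,
      so \<open>l\<close> is still positive.\<close>
    define l where "l = k - 1"
    have l: "k = Suc l" "1 \<le> l" "m - 1 - Suc t \<le> l"
      using IH(2) that unfolding l_def by linarith+
    obtain y where y: "y \<in> V" "(?p (2 * t + 1), y) \<in> E" "proj_safe V E l (?p (2 * t + 2)) y"
      using ex_proj_safe_move[OF IH(3)[unfolded l(1)] l(2) V V adj] by auto
    then have "y \<in> available V E ?h"
      by (simp add: available_def del: play.simps)
    then show ?thesis
      using higher_way_choice_safe[OF choice _ y(3)] l(3) le_trans by blast
  qed
  ultimately show ?case by (simp add: numeral_3_eq_3)
qed

section \<open>The capture time and optimality\<close>

lemma higher_way_capture_time: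
  assumes "higher_way V E \<tau>" "cop_strategy V E \<sigma>" "captured_within n \<sigma> \<tau>"
  shows "m \<le> n"
  using higher_way_survives[OF assms(1,2), of n] assms(3) by (force simp: captured_within_def)

text \<open>The upper bound comes from \<open>proj_cop\<close>; for the lower bound, every winning
  strategy must beat a fixed Higher Way robber.\<close>

lemma capt_eq: "capt V E = enat m"
proof (rule antisym)
  show "capt V E \<le> enat m"
    unfolding capt_def using proj_cop_strategy proj_cop_wins by (intro Inf_lower) blast
  obtain \<tau> where \<tau>: "higher_way V E \<tau>" using ex_higher_way by blast
  then have \<tau>s: "robber_strategy V E \<tau>" by (simp add: higher_way_def)
  show "enat m \<le> capt V E"
    unfolding capt_def
  proof (rule Inf_greatest)
    fix x assume "x \<in> {enat n |n. \<exists>\<sigma>. cop_strategy V E \<sigma> \<and> wins_within V E n \<sigma>}"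
    then obtain n \<sigma> where "x = enat n" "cop_strategy V E \<sigma>" "wins_within V E n \<sigma>" by blast
    with \<tau> \<tau>s show "enat m \<le> x"
      using higher_way_capture_time by (auto simp: wins_within_def)
  qed
qed

lemma lower_way_optimal: "lower_way V E \<alpha> \<sigma> \<Longrightarrow> optimal_cop V E \<sigma>"
  using lower_way_wins capt_eq by (auto simp: optimal_cop_def lower_way_def)

lemma higher_way_optimal: "higher_way V E \<tau> \<Longrightarrow> optimal_robber V E \<tau>"
  using higher_way_capture_time capt_eq by (auto simp: optimal_robber_def higher_way_def)

end

theorem theorem6p2:
  fixes V :: "'a set" and E :: "('a \<times> 'a) set" and \<alpha> :: nat
  assumes "reflexive_graph V E"
    and "graph_corner_rank V E = enat \<alpha>"
    and "\<alpha> \<ge> 2"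
  shows "(\<forall>\<sigma>. lower_way V E \<alpha> \<sigma> \<longrightarrow> optimal_cop V E \<sigma>) \<and>
         (\<forall>\<tau>. higher_way V E \<tau> \<longrightarrow> optimal_robber V E \<tau>)"
proof -
  interpret ranked_graph V E \<alpha>
    using assms by unfold_locales
  show ?thesis
    using lower_way_optimal higher_way_optimal by blast
qed

end
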